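(* Let $n\in\mathbb{N}$ and let $\mathbf{k}$ be a commutative ring. Let $i,j\in[n-1]$ satisfy $i\leq j$. Then, in $\mathbf{k}[S_n]$, $$(1+s_j)\,[t_i,t_j]=0.$$
   Context: Here $\mathbb{N}=\{0,1,2,\ldots\}$, and $[m]:=\{1,2,\ldots,m\}$ (empty if $m\leq 0$). $S_n$ is the symmetric group on $[n]$, with product $(\pi\sigma)(i)=\pi(\sigma(i))$, viewed as a subset of the group algebra $\mathbf{k}[S_n]$. For distinct $i_1,\ldots,i_k\in[n]$, $\operatorname{cyc}_{i_1,\ldots,i_k}\in S_n$ is the cycle sending $i_1\mapsto i_2\mapsto\cdots\mapsto i_k\mapsto i_1$ and fixing all other elements (so $\operatorname{cyc}_i=\operatorname{id}=1$). For $i\in[n-1]$, $s_i:=\operatorname{cyc}_{i,i+1}$ is the simple transposition swapping $i$ and $i+1$. For each $\ell\in[n]$, the somewhere-to-below shuffle is $t_\ell:=\operatorname{cyc}_{\ell}+\operatorname{cyc}_{\ell,\ell+1}+\operatorname{cyc}_{\ell,\ell+1,\ell+2}+\cdots+\operatorname{cyc}_{\ell,\ell+1,\ldots,n}\in\mathbf{k}[S_n]$. For elements $a,b$ of a ring, $[a,b]:=ab-ba$ is the commutator. *)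

theory Defs
  imports "HOL-Algebra.Sym_Groups" "HOL-Algebra.Module"
begin

text \<open>
  The group algebra of a group \<open>G\<close> over a commutative ring \<open>R\<close>: finitely supported functions from
  \<open>carrier G\<close> to \<open>carrier R\<close> with the convolution product
  \<open>(a b)(g) = (\<Sum>h\<in>G. a(h) b(h\<^sup>-\<^sup>1 g))\<close>. The sum is restricted to the support of \<open>a\<close> since
  \<^const>\<open>finsum\<close> is only meaningful over finite sets. The coefficient ring is a record rather
  than a type of class \<open>comm_ring_1\<close>, since that class excludes the trivial ring.
\<close>

definition group_algebra ::
    "('a, 'c) ring_scheme \<Rightarrow> ('g, 'd) monoid_scheme \<Rightarrow> ('a, 'g \<Rightarrow> 'a) module" where
  "group_algebra R G =
    \<lparr> carrier = {a \<in> carrier G \<rightarrow>\<^sub>E carrier R. finite {g \<in> carrier G. a g \<noteq> \<zero>\<^bsub>R\<^esub>}},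
      mult = (\<lambda>a b. \<lambda>g\<in>carrier G.
        \<Oplus>\<^bsub>R\<^esub>h\<in>{h \<in> carrier G. a h \<noteq> \<zero>\<^bsub>R\<^esub>}. a h \<otimes>\<^bsub>R\<^esub> b (inv\<^bsub>G\<^esub> h \<otimes>\<^bsub>G\<^esub> g)),
      one = (\<lambda>g\<in>carrier G. if g = \<one>\<^bsub>G\<^esub> then \<one>\<^bsub>R\<^esub> else \<zero>\<^bsub>R\<^esub>),
      zero = (\<lambda>g\<in>carrier G. \<zero>\<^bsub>R\<^esub>),
      add = (\<lambda>a b. \<lambda>g\<in>carrier G. a g \<oplus>\<^bsub>R\<^esub> b g),
      smult = (\<lambda>c a. \<lambda>g\<in>carrier G. c \<otimes>\<^bsub>R\<^esub> a g) \<rparr>"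

text \<open>The image of a group element under the embedding of \<open>G\<close> into its group algebra.\<close>

definition group_elem ::
    "('a, 'c) ring_scheme \<Rightarrow> ('g, 'd) monoid_scheme \<Rightarrow> 'g \<Rightarrow> ('g \<Rightarrow> 'a)" where
  "group_elem R G g = (\<lambda>h\<in>carrier G. if h = g then \<one>\<^bsub>R\<^esub> else \<zero>\<^bsub>R\<^esub>)"

definition commutator :: "('a, 'c) ring_scheme \<Rightarrow> 'a \<Rightarrow> 'a \<Rightarrow> 'a" where
  "commutator A a b = (a \<otimes>\<^bsub>A\<^esub> b) \<ominus>\<^bsub>A\<^esub> (b \<otimes>\<^bsub>A\<^esub> a)"

text \<open>
  \<^const>\<open>sym_group\<close> has the product \<open>(\<pi> \<sigma>)(i) = \<pi> (\<sigma> i)\<close> on the permutations of \<open>{1..n}\<close>, and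
  \<^term>\<open>cycle_of_list [i\<^sub>1, i\<^sub>2, i\<^sub>3]\<close> maps each entry to the next one and the last one to the first
  (see \<open>cyclic_rotation\<close>).
\<close>

abbreviation sym_group_algebra ::
    "('a, 'c) ring_scheme \<Rightarrow> nat \<Rightarrow> ('a, (nat \<Rightarrow> nat) \<Rightarrow> 'a) module" where
  "sym_group_algebra R n \<equiv> group_algebra R (sym_group n)"

definition simple_transp ::
    "('a, 'c) ring_scheme \<Rightarrow> nat \<Rightarrow> nat \<Rightarrow> ((nat \<Rightarrow> nat) \<Rightarrow> 'a)" where
  "simple_transp R n i = group_elem R (sym_group n) (cycle_of_list [i, i + 1])"

text \<open>The summand with index \<open>m\<close> is the cycle through \<open>l, l + 1, \<dots>, m\<close>.\<close>

definition somewhere_to_below ::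
    "('a, 'c) ring_scheme \<Rightarrow> nat \<Rightarrow> nat \<Rightarrow> ((nat \<Rightarrow> nat) \<Rightarrow> 'a)" where
  "somewhere_to_below R n l =
    (\<Oplus>\<^bsub>sym_group_algebra R n\<^esub>m\<in>{l..n}. group_elem R (sym_group n) (cycle_of_list [l..<m + 1]))"


subsection \<open>The group algebra is a ring and a module\<close>

lemma (in abelian_monoid) finsum_swap:
  assumes "finite A" "finite B" "\<And>x y. x \<in> A \<Longrightarrow> y \<in> B \<Longrightarrow> f x y \<in> carrier G"
  shows "(\<Oplus>x\<in>A. \<Oplus>y\<in>B. f x y) = (\<Oplus>y\<in>B. \<Oplus>x\<in>A. f x y)"
  using assms(1,3)
proof (induction A rule: finite_induct)
  case empty
  then show ?case by simp
next
  case (insert a A)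
  have "(\<Oplus>x\<in>insert a A. \<Oplus>y\<in>B. f x y) = (\<Oplus>y\<in>B. f a y) \<oplus> (\<Oplus>y\<in>B. \<Oplus>x\<in>A. f x y)"
    using insert by (subst finsum_insert) (auto intro!: finsum_closed)
  also have "\<dots> = (\<Oplus>y\<in>B. f a y \<oplus> (\<Oplus>x\<in>A. f x y))"
    using insert by (subst finsum_addf) (auto intro!: finsum_closed)
  also have "\<dots> = (\<Oplus>y\<in>B. \<Oplus>x\<in>insert a A. f x y)"
    using insert by (intro finsum_cong') (auto intro!: finsum_closed finsum_insert [symmetric])
  finally show ?case .
qed

locale group_algebra_setup = R?: cring R + G?: group G
  for R :: "('a, 'c) ring_scheme" (structure) and G :: "('g, 'd) monoid_scheme" (structure)
begin

abbreviation A where "A \<equiv> group_algebra R G"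

abbreviation supp where "supp a \<equiv> {g \<in> carrier G. a g \<noteq> \<zero>\<^bsub>R\<^esub>}"

lemma in_carrier_iff:
  "a \<in> carrier A \<longleftrightarrow> a \<in> carrier G \<rightarrow>\<^sub>E carrier R \<and> finite (supp a)"
  by (simp add: group_algebra_def)

lemma coeff_closed: "a \<in> carrier A \<Longrightarrow> g \<in> carrier G \<Longrightarrow> a g \<in> carrier R"
  by (auto simp: in_carrier_iff)

lemma ext: "a \<in> carrier A \<Longrightarrow> b \<in> carrier A \<Longrightarrow> (\<And>g. g \<in> carrier G \<Longrightarrow> a g = b g) \<Longrightarrow> a = b"
  by (auto simp: in_carrier_iff intro: PiE_ext)

lemma coeff_simps:
  assumes "g \<in> carrier G"
  shows "(a \<oplus>\<^bsub>A\<^esub> b) g = a g \<oplus>\<^bsub>R\<^esub> b g" "\<zero>\<^bsub>A\<^esub> g = \<zero>\<^bsub>R\<^esub>"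
    "\<one>\<^bsub>A\<^esub> g = (if g = \<one>\<^bsub>G\<^esub> then \<one>\<^bsub>R\<^esub> else \<zero>\<^bsub>R\<^esub>)"
    "(r \<odot>\<^bsub>A\<^esub> a) g = r \<otimes>\<^bsub>R\<^esub> a g"
  using assms by (simp_all add: group_algebra_def)

lemma coeff_mult:
  assumes a: "a \<in> carrier A" and b: "b \<in> carrier A" and g: "g \<in> carrier G"
    and S: "finite S" "S \<subseteq> carrier G" "supp a \<subseteq> S"
  shows "(a \<otimes>\<^bsub>A\<^esub> b) g = (\<Oplus>\<^bsub>R\<^esub>h\<in>S. a h \<otimes>\<^bsub>R\<^esub> b (inv\<^bsub>G\<^esub> h \<otimes>\<^bsub>G\<^esub> g))"
proof -
  have "(a \<otimes>\<^bsub>A\<^esub> b) g = (\<Oplus>\<^bsub>R\<^esub>h\<in>supp a. a h \<otimes>\<^bsub>R\<^esub> b (inv\<^bsub>G\<^esub> h \<otimes>\<^bsub>G\<^esub> g))"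
    using g by (simp add: group_algebra_def)
  also have "\<dots> = (\<Oplus>\<^bsub>R\<^esub>h\<in>S. a h \<otimes>\<^bsub>R\<^esub> b (inv\<^bsub>G\<^esub> h \<otimes>\<^bsub>G\<^esub> g))"
    using assms coeff_closed
    by (intro R.add.finprod_mono_neutral_cong_left) (auto simp: subset_iff)
  finally show ?thesis .
qed

lemma carrierI:
  assumes "a \<in> extensional (carrier G)" "\<And>g. g \<in> carrier G \<Longrightarrow> a g \<in> carrier R"
    "finite S" "\<And>g. g \<in> carrier G \<Longrightarrow> g \<notin> S \<Longrightarrow> a g = \<zero>\<^bsub>R\<^esub>"
  shows "a \<in> carrier A"
proof -
  have "supp a \<subseteq> S" using assms(4) by auto
  then show ?thesis using assms finite_subset by (auto simp: in_carrier_iff PiE_def)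
qed

lemma add_closed: "a \<in> carrier A \<Longrightarrow> b \<in> carrier A \<Longrightarrow> a \<oplus>\<^bsub>A\<^esub> b \<in> carrier A"
  by (rule carrierI [where S = "supp a \<union> supp b"])
    (auto simp: coeff_simps coeff_closed in_carrier_iff, auto simp: group_algebra_def)

lemma zero_in: "\<zero>\<^bsub>A\<^esub> \<in> carrier A"
  by (rule carrierI [where S = "{}"]) (auto simp: coeff_simps, auto simp: group_algebra_def)

lemma one_in: "\<one>\<^bsub>A\<^esub> \<in> carrier A"
  by (rule carrierI [where S = "{\<one>\<^bsub>G\<^esub>}"]) (auto simp: coeff_simps, auto simp: group_algebra_def)

lemma group_elem_in: "group_elem R G g \<in> carrier A"
  by (rule carrierI [where S = "{g}"]) (auto simp: group_elem_def)

lemma smult_in: "r \<in> carrier R \<Longrightarrow> a \<in> carrier A \<Longrightarrow> r \<odot>\<^bsub>A\<^esub> a \<in> carrier A"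
  by (rule carrierI [where S = "supp a"])
    (auto simp: coeff_simps coeff_closed in_carrier_iff, auto simp: group_algebra_def)

lemma supp_mult:
  assumes a: "a \<in> carrier A" and b: "b \<in> carrier A" and g: "g \<in> carrier G"
    and n: "g \<notin> (\<lambda>(x, y). x \<otimes>\<^bsub>G\<^esub> y) ` (supp a \<times> supp b)"
  shows "(a \<otimes>\<^bsub>A\<^esub> b) g = \<zero>\<^bsub>R\<^esub>"
proof -
  have "b (inv\<^bsub>G\<^esub> h \<otimes>\<^bsub>G\<^esub> g) = \<zero>\<^bsub>R\<^esub>" if h: "h \<in> supp a" for h
  proof (rule ccontr)
    assume "b (inv\<^bsub>G\<^esub> h \<otimes>\<^bsub>G\<^esub> g) \<noteq> \<zero>\<^bsub>R\<^esub>"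
    moreover have "h \<otimes>\<^bsub>G\<^esub> (inv\<^bsub>G\<^esub> h \<otimes>\<^bsub>G\<^esub> g) = g"
      using h g by (simp add: G.m_assoc [symmetric])
    ultimately have "g \<in> (\<lambda>(x, y). x \<otimes>\<^bsub>G\<^esub> y) ` (supp a \<times> supp b)"
      using h g by (intro image_eqI [where x = "(h, inv\<^bsub>G\<^esub> h \<otimes>\<^bsub>G\<^esub> g)"]) auto
    with n show False by blast
  qed
  then have "(\<Oplus>\<^bsub>R\<^esub>h\<in>supp a. a h \<otimes>\<^bsub>R\<^esub> b (inv\<^bsub>G\<^esub> h \<otimes>\<^bsub>G\<^esub> g)) = \<zero>\<^bsub>R\<^esub>"
    using a coeff_closed by (intro R.add.finprod_one_eqI) auto
  then show ?thesis using g by (simp add: group_algebra_def)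
qed

lemma mult_in: assumes a: "a \<in> carrier A" and b: "b \<in> carrier A" shows "a \<otimes>\<^bsub>A\<^esub> b \<in> carrier A"
proof (rule carrierI)
  show "a \<otimes>\<^bsub>A\<^esub> b \<in> extensional (carrier G)" by (simp add: group_algebra_def)
  show "finite ((\<lambda>(x, y). x \<otimes>\<^bsub>G\<^esub> y) ` (supp a \<times> supp b))"
    using a b by (simp add: in_carrier_iff)
  show "(a \<otimes>\<^bsub>A\<^esub> b) g \<in> carrier R" if "g \<in> carrier G" for g
    using that a b coeff_closed
    by (subst coeff_mult [where S = "supp a"]) (auto simp: in_carrier_iff intro!: R.finsum_closed)
qed (rule supp_mult [OF a b])

lemma mult_assoc:
  assumes a: "a \<in> carrier A" and b: "b \<in> carrier A" and c: "c \<in> carrier A"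
  shows "(a \<otimes>\<^bsub>A\<^esub> b) \<otimes>\<^bsub>A\<^esub> c = a \<otimes>\<^bsub>A\<^esub> (b \<otimes>\<^bsub>A\<^esub> c)"
proof (rule ext)
  fix g assume g: "g \<in> carrier G"
  define S where "S = (\<lambda>(x, y). x \<otimes>\<^bsub>G\<^esub> y) ` (supp a \<times> supp b)"
  have fin: "finite S" "finite (supp a)" using a b by (simp_all add: S_def in_carrier_iff)
  have S: "S \<subseteq> carrier G" by (auto simp: S_def)
  note cl = coeff_closed [OF a] coeff_closed [OF b] coeff_closed [OF c]
  let ?i = "\<lambda>h. inv\<^bsub>G\<^esub> h"
  have "((a \<otimes>\<^bsub>A\<^esub> b) \<otimes>\<^bsub>A\<^esub> c) g = (\<Oplus>\<^bsub>R\<^esub>h\<in>S. (a \<otimes>\<^bsub>A\<^esub> b) h \<otimes>\<^bsub>R\<^esub> c (?i h \<otimes>\<^bsub>G\<^esub> g))"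
    using supp_mult [OF a b] by (intro coeff_mult mult_in a b c g fin S) (auto simp: S_def)
  also have "\<dots> = (\<Oplus>\<^bsub>R\<^esub>h\<in>S. \<Oplus>\<^bsub>R\<^esub>x\<in>supp a. a x \<otimes>\<^bsub>R\<^esub> b (?i x \<otimes>\<^bsub>G\<^esub> h) \<otimes>\<^bsub>R\<^esub> c (?i h \<otimes>\<^bsub>G\<^esub> g))"
  proof (rule R.finsum_cong')
    show "(\<lambda>h. \<Oplus>\<^bsub>R\<^esub>x\<in>supp a. a x \<otimes>\<^bsub>R\<^esub> b (?i x \<otimes>\<^bsub>G\<^esub> h) \<otimes>\<^bsub>R\<^esub> c (?i h \<otimes>\<^bsub>G\<^esub> g)) \<in> S \<rightarrow> carrier R"
      using S g cl by (auto intro!: R.finsum_closed)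
    fix h assume "h \<in> S"
    then have h: "h \<in> carrier G" using S by auto
    have "(a \<otimes>\<^bsub>A\<^esub> b) h = (\<Oplus>\<^bsub>R\<^esub>x\<in>supp a. a x \<otimes>\<^bsub>R\<^esub> b (?i x \<otimes>\<^bsub>G\<^esub> h))"
      using fin h by (intro coeff_mult a b) auto
    then show "(a \<otimes>\<^bsub>A\<^esub> b) h \<otimes>\<^bsub>R\<^esub> c (?i h \<otimes>\<^bsub>G\<^esub> g) =
        (\<Oplus>\<^bsub>R\<^esub>x\<in>supp a. a x \<otimes>\<^bsub>R\<^esub> b (?i x \<otimes>\<^bsub>G\<^esub> h) \<otimes>\<^bsub>R\<^esub> c (?i h \<otimes>\<^bsub>G\<^esub> g))"
      using fin h g cl by (simp add: R.finsum_ldistr)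
  qed simp
  also have "\<dots> = (\<Oplus>\<^bsub>R\<^esub>x\<in>supp a. \<Oplus>\<^bsub>R\<^esub>h\<in>S. a x \<otimes>\<^bsub>R\<^esub> b (?i x \<otimes>\<^bsub>G\<^esub> h) \<otimes>\<^bsub>R\<^esub> c (?i h \<otimes>\<^bsub>G\<^esub> g))"
    using fin S g cl by (intro R.finsum_swap) auto
  also have "\<dots> = (\<Oplus>\<^bsub>R\<^esub>x\<in>supp a. a x \<otimes>\<^bsub>R\<^esub> (b \<otimes>\<^bsub>A\<^esub> c) (?i x \<otimes>\<^bsub>G\<^esub> g))"
  proof (rule R.finsum_cong')
    show "(\<lambda>x. a x \<otimes>\<^bsub>R\<^esub> (b \<otimes>\<^bsub>A\<^esub> c) (?i x \<otimes>\<^bsub>G\<^esub> g)) \<in> supp a \<rightarrow> carrier R"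
      using g cl coeff_closed [OF mult_in [OF b c]] by auto
    fix x assume x: "x \<in> supp a"
    let ?T = "(\<lambda>h. ?i x \<otimes>\<^bsub>G\<^esub> h) ` S"
    have inj: "inj_on (\<lambda>h. ?i x \<otimes>\<^bsub>G\<^esub> h) S"
      using x S by (auto simp: inj_on_def subset_iff)
    have sub: "supp b \<subseteq> ?T"
    proof
      fix y assume y: "y \<in> supp b"
      then have "x \<otimes>\<^bsub>G\<^esub> y \<in> S" using x by (force simp: S_def)
      moreover have "y = ?i x \<otimes>\<^bsub>G\<^esub> (x \<otimes>\<^bsub>G\<^esub> y)" using x y by (simp add: G.m_assoc [symmetric])
      ultimately show "y \<in> ?T" by blast
    qed
    have "(b \<otimes>\<^bsub>A\<^esub> c) (?i x \<otimes>\<^bsub>G\<^esub> g) = (\<Oplus>\<^bsub>R\<^esub>y\<in>?T. b y \<otimes>\<^bsub>R\<^esub> c (?i y \<otimes>\<^bsub>G\<^esub> (?i x \<otimes>\<^bsub>G\<^esub> g)))"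
      using fin S x g sub by (intro coeff_mult b c) auto
    also have "\<dots> = (\<Oplus>\<^bsub>R\<^esub>h\<in>S. b (?i x \<otimes>\<^bsub>G\<^esub> h) \<otimes>\<^bsub>R\<^esub> c (?i (?i x \<otimes>\<^bsub>G\<^esub> h) \<otimes>\<^bsub>G\<^esub> (?i x \<otimes>\<^bsub>G\<^esub> g)))"
      using S x g cl by (intro R.finsum_reindex inj) auto
    also have "\<dots> = (\<Oplus>\<^bsub>R\<^esub>h\<in>S. b (?i x \<otimes>\<^bsub>G\<^esub> h) \<otimes>\<^bsub>R\<^esub> c (?i h \<otimes>\<^bsub>G\<^esub> g))"
    proof (rule R.finsum_cong')
      fix h assume "h \<in> S"
      then have h: "h \<in> carrier G" using S by auto
      have "x \<otimes>\<^bsub>G\<^esub> (?i x \<otimes>\<^bsub>G\<^esub> g) = g"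
        using x g by (simp add: G.m_assoc [symmetric])
      then have "?i (?i x \<otimes>\<^bsub>G\<^esub> h) \<otimes>\<^bsub>G\<^esub> (?i x \<otimes>\<^bsub>G\<^esub> g) = ?i h \<otimes>\<^bsub>G\<^esub> g"
        using h x g by (simp add: G.inv_mult_group G.m_assoc)
      then show "b (?i x \<otimes>\<^bsub>G\<^esub> h) \<otimes>\<^bsub>R\<^esub> c (?i (?i x \<otimes>\<^bsub>G\<^esub> h) \<otimes>\<^bsub>G\<^esub> (?i x \<otimes>\<^bsub>G\<^esub> g)) =
          b (?i x \<otimes>\<^bsub>G\<^esub> h) \<otimes>\<^bsub>R\<^esub> c (?i h \<otimes>\<^bsub>G\<^esub> g)"
        using h x g by simp
    qed (use S x g cl in auto)
    finally have eq: "(b \<otimes>\<^bsub>A\<^esub> c) (?i x \<otimes>\<^bsub>G\<^esub> g) = \<dots>" .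
    have "a x \<otimes>\<^bsub>R\<^esub> (\<Oplus>\<^bsub>R\<^esub>h\<in>S. b (?i x \<otimes>\<^bsub>G\<^esub> h) \<otimes>\<^bsub>R\<^esub> c (?i h \<otimes>\<^bsub>G\<^esub> g)) =
        (\<Oplus>\<^bsub>R\<^esub>h\<in>S. a x \<otimes>\<^bsub>R\<^esub> (b (?i x \<otimes>\<^bsub>G\<^esub> h) \<otimes>\<^bsub>R\<^esub> c (?i h \<otimes>\<^bsub>G\<^esub> g)))"
      using fin S x g cl by (intro R.finsum_rdistr) auto
    also have "\<dots> = (\<Oplus>\<^bsub>R\<^esub>h\<in>S. a x \<otimes>\<^bsub>R\<^esub> b (?i x \<otimes>\<^bsub>G\<^esub> h) \<otimes>\<^bsub>R\<^esub> c (?i h \<otimes>\<^bsub>G\<^esub> g))"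
      using S x g cl by (intro R.finsum_cong') (auto simp: R.m_assoc subset_iff)
    finally show "(\<Oplus>\<^bsub>R\<^esub>h\<in>S. a x \<otimes>\<^bsub>R\<^esub> b (?i x \<otimes>\<^bsub>G\<^esub> h) \<otimes>\<^bsub>R\<^esub> c (?i h \<otimes>\<^bsub>G\<^esub> g)) =
        a x \<otimes>\<^bsub>R\<^esub> (b \<otimes>\<^bsub>A\<^esub> c) (?i x \<otimes>\<^bsub>G\<^esub> g)"
      by (simp only: eq)
  qed simp
  also have "\<dots> = (a \<otimes>\<^bsub>A\<^esub> (b \<otimes>\<^bsub>A\<^esub> c)) g"
    using fin by (intro coeff_mult [symmetric] a b c g mult_in) auto
  finally show "((a \<otimes>\<^bsub>A\<^esub> b) \<otimes>\<^bsub>A\<^esub> c) g = (a \<otimes>\<^bsub>A\<^esub> (b \<otimes>\<^bsub>A\<^esub> c)) g" .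
qed (intro mult_in a b c)+

lemma group_elem_mult:
  assumes g: "g \<in> carrier G" and a: "a \<in> carrier A" and k: "k \<in> carrier G"
  shows "(group_elem R G g \<otimes>\<^bsub>A\<^esub> a) k = a (inv\<^bsub>G\<^esub> g \<otimes>\<^bsub>G\<^esub> k)"
proof -
  have "(group_elem R G g \<otimes>\<^bsub>A\<^esub> a) k =
      (\<Oplus>\<^bsub>R\<^esub>h\<in>{g}. group_elem R G g h \<otimes>\<^bsub>R\<^esub> a (inv\<^bsub>G\<^esub> h \<otimes>\<^bsub>G\<^esub> k))"
    using g k by (intro coeff_mult group_elem_in a) (auto simp: group_elem_def)
  also have "\<dots> = a (inv\<^bsub>G\<^esub> g \<otimes>\<^bsub>G\<^esub> k)"
    using g k coeff_closed [OF a] by (subst R.finsum_insert) (auto simp: group_elem_def)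
  finally show ?thesis .
qed

lemma group_elem_one: "group_elem R G \<one>\<^bsub>G\<^esub> = \<one>\<^bsub>A\<^esub>"
  by (simp add: group_elem_def group_algebra_def)

lemma group_elem_mult_group_elem:
  assumes "g \<in> carrier G" "h \<in> carrier G"
  shows "group_elem R G g \<otimes>\<^bsub>A\<^esub> group_elem R G h = group_elem R G (g \<otimes>\<^bsub>G\<^esub> h)"
proof (rule ext)
  fix k assume k: "k \<in> carrier G"
  then have "inv\<^bsub>G\<^esub> g \<otimes>\<^bsub>G\<^esub> k = h \<longleftrightarrow> k = g \<otimes>\<^bsub>G\<^esub> h"
    using assms by (metis G.inv_solve_left)
  then show "(group_elem R G g \<otimes>\<^bsub>A\<^esub> group_elem R G h) k = group_elem R G (g \<otimes>\<^bsub>G\<^esub> h) k"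
    using assms k by (simp add: group_elem_mult group_elem_in) (simp add: group_elem_def)
qed (intro mult_in group_elem_in)+

lemma one_mult: "a \<in> carrier A \<Longrightarrow> \<one>\<^bsub>A\<^esub> \<otimes>\<^bsub>A\<^esub> a = a"
  by (rule ext) (auto simp: group_elem_one [symmetric] group_elem_mult group_elem_in mult_in)

lemma mult_one: assumes a: "a \<in> carrier A" shows "a \<otimes>\<^bsub>A\<^esub> \<one>\<^bsub>A\<^esub> = a"
proof (rule ext)
  fix g assume g: "g \<in> carrier G"
  let ?S = "insert g (supp a)"
  have S: "finite ?S" using a by (simp add: in_carrier_iff)
  have "(a \<otimes>\<^bsub>A\<^esub> \<one>\<^bsub>A\<^esub>) g = (\<Oplus>\<^bsub>R\<^esub>h\<in>?S. a h \<otimes>\<^bsub>R\<^esub> \<one>\<^bsub>A\<^esub> (inv\<^bsub>G\<^esub> h \<otimes>\<^bsub>G\<^esub> g))"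
    using S g by (intro coeff_mult a one_in) auto
  also have "\<dots> = (\<Oplus>\<^bsub>R\<^esub>h\<in>?S. if g = h then a h else \<zero>\<^bsub>R\<^esub>)"
  proof (rule R.finsum_cong')
    fix h assume "h \<in> ?S"
    then have h: "h \<in> carrier G" using g by auto
    have "inv\<^bsub>G\<^esub> h \<otimes>\<^bsub>G\<^esub> g = \<one>\<^bsub>G\<^esub> \<longleftrightarrow> g = h"
      using g h by (metis G.inv_solve_left G.one_closed G.r_one)
    then show "a h \<otimes>\<^bsub>R\<^esub> \<one>\<^bsub>A\<^esub> (inv\<^bsub>G\<^esub> h \<otimes>\<^bsub>G\<^esub> g) = (if g = h then a h else \<zero>\<^bsub>R\<^esub>)"
      using g h coeff_closed [OF a] by (simp add: coeff_simps)
  qed (use g coeff_closed [OF a] in auto)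
  also have "\<dots> = a g"
    using S g coeff_closed [OF a] by (intro R.finsum_singleton) auto
  finally show "(a \<otimes>\<^bsub>A\<^esub> \<one>\<^bsub>A\<^esub>) g = a g" .
qed (intro mult_in one_in a)+

lemma add_mult:
  assumes a: "a \<in> carrier A" and b: "b \<in> carrier A" and c: "c \<in> carrier A"
  shows "(a \<oplus>\<^bsub>A\<^esub> b) \<otimes>\<^bsub>A\<^esub> c = (a \<otimes>\<^bsub>A\<^esub> c) \<oplus>\<^bsub>A\<^esub> (b \<otimes>\<^bsub>A\<^esub> c)"
proof (rule ext)
  fix g assume g: "g \<in> carrier G"
  let ?S = "supp a \<union> supp b"
  let ?c = "\<lambda>h. c (inv\<^bsub>G\<^esub> h \<otimes>\<^bsub>G\<^esub> g)"
  have S: "finite ?S" using a b by (simp add: in_carrier_iff)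
  note cl = coeff_closed [OF a] coeff_closed [OF b] coeff_closed [OF c]
  have "((a \<oplus>\<^bsub>A\<^esub> b) \<otimes>\<^bsub>A\<^esub> c) g = (\<Oplus>\<^bsub>R\<^esub>h\<in>?S. (a \<oplus>\<^bsub>A\<^esub> b) h \<otimes>\<^bsub>R\<^esub> ?c h)"
    using S by (intro coeff_mult add_closed a b c g) (auto simp: coeff_simps)
  also have "\<dots> = (\<Oplus>\<^bsub>R\<^esub>h\<in>?S. a h \<otimes>\<^bsub>R\<^esub> ?c h \<oplus>\<^bsub>R\<^esub> b h \<otimes>\<^bsub>R\<^esub> ?c h)"
    using g cl by (intro R.finsum_cong') (auto simp: coeff_simps R.l_distr)
  also have "\<dots> = (\<Oplus>\<^bsub>R\<^esub>h\<in>?S. a h \<otimes>\<^bsub>R\<^esub> ?c h) \<oplus>\<^bsub>R\<^esub> (\<Oplus>\<^bsub>R\<^esub>h\<in>?S. b h \<otimes>\<^bsub>R\<^esub> ?c h)"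
    using g cl by (intro R.finsum_addf) auto
  also have "(\<Oplus>\<^bsub>R\<^esub>h\<in>?S. a h \<otimes>\<^bsub>R\<^esub> ?c h) = (a \<otimes>\<^bsub>A\<^esub> c) g"
    using S by (intro coeff_mult [symmetric] a c g) auto
  also have "(\<Oplus>\<^bsub>R\<^esub>h\<in>?S. b h \<otimes>\<^bsub>R\<^esub> ?c h) = (b \<otimes>\<^bsub>A\<^esub> c) g"
    using S by (intro coeff_mult [symmetric] b c g) auto
  finally show "((a \<oplus>\<^bsub>A\<^esub> b) \<otimes>\<^bsub>A\<^esub> c) g = ((a \<otimes>\<^bsub>A\<^esub> c) \<oplus>\<^bsub>A\<^esub> (b \<otimes>\<^bsub>A\<^esub> c)) g"
    using g by (simp add: coeff_simps)
qed (intro add_closed mult_in a b c)+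

lemma mult_add:
  assumes a: "a \<in> carrier A" and b: "b \<in> carrier A" and c: "c \<in> carrier A"
  shows "c \<otimes>\<^bsub>A\<^esub> (a \<oplus>\<^bsub>A\<^esub> b) = (c \<otimes>\<^bsub>A\<^esub> a) \<oplus>\<^bsub>A\<^esub> (c \<otimes>\<^bsub>A\<^esub> b)"
proof (rule ext)
  fix g assume g: "g \<in> carrier G"
  let ?j = "\<lambda>h. inv\<^bsub>G\<^esub> h \<otimes>\<^bsub>G\<^esub> g"
  have S: "finite (supp c)" using c by (simp add: in_carrier_iff)
  note cl = coeff_closed [OF a] coeff_closed [OF b] coeff_closed [OF c]
  have "(c \<otimes>\<^bsub>A\<^esub> (a \<oplus>\<^bsub>A\<^esub> b)) g = (\<Oplus>\<^bsub>R\<^esub>h\<in>supp c. c h \<otimes>\<^bsub>R\<^esub> (a \<oplus>\<^bsub>A\<^esub> b) (?j h))"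
    using S by (intro coeff_mult add_closed a b c g) auto
  also have "\<dots> = (\<Oplus>\<^bsub>R\<^esub>h\<in>supp c. c h \<otimes>\<^bsub>R\<^esub> a (?j h) \<oplus>\<^bsub>R\<^esub> c h \<otimes>\<^bsub>R\<^esub> b (?j h))"
    using g cl by (intro R.finsum_cong') (auto simp: coeff_simps R.r_distr)
  also have "\<dots> = (\<Oplus>\<^bsub>R\<^esub>h\<in>supp c. c h \<otimes>\<^bsub>R\<^esub> a (?j h)) \<oplus>\<^bsub>R\<^esub> (\<Oplus>\<^bsub>R\<^esub>h\<in>supp c. c h \<otimes>\<^bsub>R\<^esub> b (?j h))"
    using g cl by (intro R.finsum_addf) auto
  also have "(\<Oplus>\<^bsub>R\<^esub>h\<in>supp c. c h \<otimes>\<^bsub>R\<^esub> a (?j h)) = (c \<otimes>\<^bsub>A\<^esub> a) g"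
    using S by (intro coeff_mult [symmetric] a c g) auto
  also have "(\<Oplus>\<^bsub>R\<^esub>h\<in>supp c. c h \<otimes>\<^bsub>R\<^esub> b (?j h)) = (c \<otimes>\<^bsub>A\<^esub> b) g"
    using S by (intro coeff_mult [symmetric] b c g) auto
  finally show "(c \<otimes>\<^bsub>A\<^esub> (a \<oplus>\<^bsub>A\<^esub> b)) g = ((c \<otimes>\<^bsub>A\<^esub> a) \<oplus>\<^bsub>A\<^esub> (c \<otimes>\<^bsub>A\<^esub> b)) g"
    using g by (simp add: coeff_simps)
qed (intro add_closed mult_in a b c)+

lemma abelian_group_A: "abelian_group A"
proof (rule abelian_groupI)
  fix a assume a: "a \<in> carrier A"
  have "((\<ominus>\<^bsub>R\<^esub> \<one>\<^bsub>R\<^esub>) \<odot>\<^bsub>A\<^esub> a) \<oplus>\<^bsub>A\<^esub> a = \<zero>\<^bsub>A\<^esub>"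
    using coeff_closed [OF a]
    by (intro ext add_closed smult_in zero_in a) (auto simp: coeff_simps R.l_minus R.l_neg)
  then show "\<exists>b\<in>carrier A. b \<oplus>\<^bsub>A\<^esub> a = \<zero>\<^bsub>A\<^esub>"
    using smult_in a by blast
qed (auto intro!: ext add_closed zero_in simp: coeff_simps coeff_closed R.a_ac)

lemma ring_A: "ring A"
  by (rule ringI)
    (auto intro!: abelian_group_A monoidI mult_in one_in
      simp: mult_assoc one_mult mult_one add_mult mult_add)

lemma module_A: "module R A"
  by (rule moduleI)
    (auto intro!: R.is_cring abelian_group_A ext smult_in add_closed
      simp: coeff_simps coeff_closed R.l_distr R.r_distr R.m_assoc)

lemma smult_mult:
  assumes r: "r \<in> carrier R" and a: "a \<in> carrier A" and b: "b \<in> carrier A"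
  shows "(r \<odot>\<^bsub>A\<^esub> a) \<otimes>\<^bsub>A\<^esub> b = r \<odot>\<^bsub>A\<^esub> (a \<otimes>\<^bsub>A\<^esub> b)"
    and "a \<otimes>\<^bsub>A\<^esub> (r \<odot>\<^bsub>A\<^esub> b) = r \<odot>\<^bsub>A\<^esub> (a \<otimes>\<^bsub>A\<^esub> b)"
proof -
  have S: "finite (supp a)" using a by (simp add: in_carrier_iff)
  note cl = coeff_closed [OF a] coeff_closed [OF b]
  {
    fix g assume g: "g \<in> carrier G"
    let ?b = "\<lambda>h. b (inv\<^bsub>G\<^esub> h \<otimes>\<^bsub>G\<^esub> g)"
    have *: "(a \<otimes>\<^bsub>A\<^esub> b) g = (\<Oplus>\<^bsub>R\<^esub>h\<in>supp a. a h \<otimes>\<^bsub>R\<^esub> ?b h)"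
      using S by (intro coeff_mult a b g) auto
    have 0: "(r \<odot>\<^bsub>A\<^esub> (a \<otimes>\<^bsub>A\<^esub> b)) g = (\<Oplus>\<^bsub>R\<^esub>h\<in>supp a. r \<otimes>\<^bsub>R\<^esub> (a h \<otimes>\<^bsub>R\<^esub> ?b h))"
      using S g cl r by (simp add: coeff_simps *) (intro R.finsum_rdistr, auto)
    have "((r \<odot>\<^bsub>A\<^esub> a) \<otimes>\<^bsub>A\<^esub> b) g = (\<Oplus>\<^bsub>R\<^esub>h\<in>supp a. (r \<odot>\<^bsub>A\<^esub> a) h \<otimes>\<^bsub>R\<^esub> ?b h)"
      using S r by (intro coeff_mult smult_in a b g) (auto simp: coeff_simps)
    also have "\<dots> = (\<Oplus>\<^bsub>R\<^esub>h\<in>supp a. r \<otimes>\<^bsub>R\<^esub> (a h \<otimes>\<^bsub>R\<^esub> ?b h))"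
      using g cl r by (intro R.finsum_cong') (auto simp: coeff_simps R.m_assoc)
    finally have 1: "((r \<odot>\<^bsub>A\<^esub> a) \<otimes>\<^bsub>A\<^esub> b) g = (r \<odot>\<^bsub>A\<^esub> (a \<otimes>\<^bsub>A\<^esub> b)) g" by (simp only: 0)
    have "(a \<otimes>\<^bsub>A\<^esub> (r \<odot>\<^bsub>A\<^esub> b)) g =
        (\<Oplus>\<^bsub>R\<^esub>h\<in>supp a. a h \<otimes>\<^bsub>R\<^esub> (r \<odot>\<^bsub>A\<^esub> b) (inv\<^bsub>G\<^esub> h \<otimes>\<^bsub>G\<^esub> g))"
      using S r by (intro coeff_mult smult_in a b g) auto
    also have "\<dots> = (\<Oplus>\<^bsub>R\<^esub>h\<in>supp a. r \<otimes>\<^bsub>R\<^esub> (a h \<otimes>\<^bsub>R\<^esub> ?b h))"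
      using g cl r by (intro R.finsum_cong') (auto simp: coeff_simps R.m_lcomm)
    finally have "(a \<otimes>\<^bsub>A\<^esub> (r \<odot>\<^bsub>A\<^esub> b)) g = (r \<odot>\<^bsub>A\<^esub> (a \<otimes>\<^bsub>A\<^esub> b)) g" by (simp only: 0)
    note 1 this
  }
  then show "(r \<odot>\<^bsub>A\<^esub> a) \<otimes>\<^bsub>A\<^esub> b = r \<odot>\<^bsub>A\<^esub> (a \<otimes>\<^bsub>A\<^esub> b)"
    and "a \<otimes>\<^bsub>A\<^esub> (r \<odot>\<^bsub>A\<^esub> b) = r \<odot>\<^bsub>A\<^esub> (a \<otimes>\<^bsub>A\<^esub> b)"
    using r a b by (auto intro!: ext mult_in smult_in)
qed

end

end

theory Submission
  imports Defs
begin

text \<open>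
  Write \<open>c l m\<close> for the cycle through \<open>l, \<dots>, m\<close>. Since \<open>1 + s\<^sub>j\<close> absorbs a factor \<open>s\<^sub>j\<close> on its
  right, it suffices for \<open>i < j\<close> to match the products \<open>c i m \<circ> c j k\<close> with the products
  \<open>c j k' \<circ> c i m'\<close> up to left multiplication by \<open>s\<^sub>j\<close>. The cycles commute for \<open>m < j\<close>;
  one has \<open>c i m \<circ> c j k = s\<^sub>j \<circ> c j (k + 1) \<circ> c i m\<close> for \<open>j \<le> k < m\<close> and
  \<open>c i m \<circ> c j k = s\<^sub>j \<circ> c j k \<circ> c i (m - 1)\<close> for \<open>j < m \<le> k\<close>; and the products
  \<open>c i j \<circ> c j k = c i k\<close> are matched with \<open>c j j \<circ> c i k\<close>.
\<close>

lemma (in ring) finsum_mult_finsum: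
  assumes "finite I" "finite J" "a \<in> I \<rightarrow> carrier R" "b \<in> J \<rightarrow> carrier R"
  shows "(\<Oplus>m\<in>I. a m) \<otimes> (\<Oplus>k\<in>J. b k) = (\<Oplus>p\<in>I \<times> J. case p of (m, k) \<Rightarrow> a m \<otimes> b k)"
  using assms(1,3)
proof (induction I rule: finite_induct)
  case empty
  then show ?case using assms by simp
next
  case (insert x I)
  then have cl: "a x \<in> carrier R" "a \<in> I \<rightarrow> carrier R" "(\<Oplus>k\<in>J. b k) \<in> carrier R"
    using assms by auto
  have "(\<Oplus>m\<in>insert x I. a m) \<otimes> (\<Oplus>k\<in>J. b k) =
      a x \<otimes> (\<Oplus>k\<in>J. b k) \<oplus> (\<Oplus>p\<in>I \<times> J. case p of (m, k) \<Rightarrow> a m \<otimes> b k)"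
    using insert cl by (simp add: l_distr)
  also have "a x \<otimes> (\<Oplus>k\<in>J. b k) = (\<Oplus>k\<in>J. a x \<otimes> b k)"
    using assms cl by (intro finsum_rdistr) auto
  also have "\<dots> = (\<Oplus>p\<in>Pair x ` J. case p of (m, k) \<Rightarrow> a m \<otimes> b k)"
    using assms cl by (subst finsum_reindex) (auto simp: inj_on_def)
  also have "\<dots> \<oplus> (\<Oplus>p\<in>I \<times> J. case p of (m, k) \<Rightarrow> a m \<otimes> b k) =
      (\<Oplus>p\<in>Pair x ` J \<union> I \<times> J. case p of (m, k) \<Rightarrow> a m \<otimes> b k)"
    using insert assms cl by (intro finsum_Un_disjoint [symmetric]) auto
  also have "Pair x ` J \<union> I \<times> J = insert x I \<times> J"
    by auto
  finally show ?case .
qed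

text \<open>Removing the first entry \<open>l\<close> from the list splits off the left factor
  \<open>transpose l (Suc l)\<close>, so the formula follows by downward induction on
  \<open>l\<close>.\<close>

lemma cycle_of_interval_apply:
  assumes "l \<le> m"
  shows "cycle_of_list [l..<m + 1] x = (if x < l \<or> m < x then x else if x = m then l else x + 1)"
  using assms
proof (induction l arbitrary: x rule: inc_induct)
  case base
  then show ?case by simp
next
  case (step l)
  have "[l..<m + 1] = l # Suc l # [Suc (Suc l)..<m + 1]" "[Suc l..<m + 1] = Suc l # [Suc (Suc l)..<m + 1]"
    using step by (simp_all add: upt_conv_Cons)
  then have "cycle_of_list [l..<m + 1] x = transpose l (Suc l) (cycle_of_list [Suc l..<m + 1] x)"
    by simp
  then show ?case using step by (auto simp: transpose_def)
qed

lemma cycle_of_interval_in_sym_group: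
  assumes "1 \<le> l" "m \<le> n"
  shows "cycle_of_list [l..<m + 1] \<in> carrier (sym_group n)"
  using cycle_permutes [of "[l..<m + 1]"] assms
  by (auto simp: sym_group_carrier intro: permutes_subset)

text \<open>All four identities are checked pointwise. For \<open>k < m\<close>, the reason is that
  \<open>c i m\<close> shifts each of \<open>j, ..., k\<close> by one, so conjugation by it turns
  \<open>c j k\<close> into the cycle through \<open>j + 1, ..., k + 1\<close>, which is
  \<open>s \<circ> c j (k + 1)\<close>.\<close>

lemma cycle_of_interval_comp:
  fixes i j k m :: nat
  defines "c \<equiv> \<lambda>l m. cycle_of_list [l..<m + 1]" and "s \<equiv> cycle_of_list [j, j + 1]"
  assumes "i < j" "j \<le> k" "i \<le> m"
  shows cycle_of_interval_commute: "m < j \<Longrightarrow> c i m \<circ> c j k = c j k \<circ> c i m"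
    and cycle_of_interval_comp_less: "k < m \<Longrightarrow> c i m \<circ> c j k = s \<circ> (c j (k + 1) \<circ> c i m)"
    and cycle_of_interval_comp_eq: "m = j \<Longrightarrow> c i m \<circ> c j k = c j j \<circ> c i k"
    and cycle_of_interval_comp_greater:
      "j < m \<Longrightarrow> m \<le> k \<Longrightarrow> c i m \<circ> c j k = s \<circ> (c j k \<circ> c i (m - 1))"
proof -
  have c: "c l m x = (if x < l \<or> m < x then x else if x = m then l else x + 1)" if "l \<le> m" for l m x
    unfolding c_def by (rule cycle_of_interval_apply [OF that])
  have s: "s x = (if x = j then j + 1 else if x = j + 1 then j else x)" for x
    by (simp add: s_def transpose_def)
  show "m < j \<Longrightarrow> c i m \<circ> c j k = c j k \<circ> c i m"
    using assms(3-) by (intro ext) (simp add: c)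
  show "k < m \<Longrightarrow> c i m \<circ> c j k = s \<circ> (c j (k + 1) \<circ> c i m)"
    using assms(3-) by (intro ext) (simp add: c s)
  show "m = j \<Longrightarrow> c i m \<circ> c j k = c j j \<circ> c i k"
    using assms(3-) by (intro ext) (simp add: c)
  show "j < m \<Longrightarrow> m \<le> k \<Longrightarrow> c i m \<circ> c j k = s \<circ> (c j k \<circ> c i (m - 1))"
    \<comment> \<open>The split on \<open>m\<close> resolves the truncated \<open>m - 1\<close>;
      here \<open>j < m\<close> excludes \<open>m = 0\<close>.\<close>
    using assms(3-) by (intro ext, cases m) (simp_all add: c s)
qed

text \<open>This is the matching of index pairs dictated by \<open>cycle_of_interval_comp\<close>:
  one branch for each of its four identities.\<close>

lemma bij_betw_cycle_index:
  fixes i j n :: nat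
  assumes "i < j" "j \<le> n"
  shows "bij_betw (\<lambda>(m, k). if m < j then (k, m) else if k < m then (k + 1, m)
      else if m = j then (j, k) else (k, m - 1)) ({i..n} \<times> {j..n}) ({j..n} \<times> {i..n})"
    (is "bij_betw ?f ?A ?B")
proof -
  \<comment> \<open>The branches of \<open>?f\<close> have images \<open>m < j\<close>,
    \<open>j < k \<le> m\<close>, \<open>k = j \<le> m\<close> and \<open>j \<le> m < k\<close>,
    which partition the target; \<open>?g\<close> inverts \<open>?f\<close> on each of them.\<close>
  let ?g = "\<lambda>(k, m). if m < j then (m, k)
      else if k = j then (j, m) else if k \<le> m then (m, k - 1) else (m + 1, k)"
  show ?thesis
  proof (rule bij_betw_byWitness [where f' = ?g])
    have "?g (?f (m, k)) = (m, k)" if "(m, k) \<in> ?A" for m k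
      using that by (cases m) auto
    then show "\<forall>p\<in>?A. ?g (?f p) = p"
      by blast
    have "?f (?g (k, m)) = (k, m)" if "(k, m) \<in> ?B" for m k
      using that by (cases k) auto
    then show "\<forall>p\<in>?B. ?f (?g p) = p"
      by blast
    have "?f (m, k) \<in> ?B" if "(m, k) \<in> ?A" for m k
      using that assms by auto
    then show "?f ` ?A \<subseteq> ?B"
      by blast
    have "?g (k, m) \<in> ?A" if "(k, m) \<in> ?B" for k m
      using that assms by auto
    then show "?g ` ?B \<subseteq> ?A"
      by blast
  qed
qed

text \<open>Right multiplication by the involution \<open>s\<close> merely swaps the two summands of
  \<open>1 + s\<close>.\<close>

lemma (in group_algebra_setup) one_plus_involution_absorb:
  assumes "s \<in> carrier G" "s \<otimes>\<^bsub>G\<^esub> s = \<one>\<^bsub>G\<^esub>" "g \<in> carrier G"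
  shows "(\<one>\<^bsub>A\<^esub> \<oplus>\<^bsub>A\<^esub> group_elem R G s) \<otimes>\<^bsub>A\<^esub> group_elem R G (s \<otimes>\<^bsub>G\<^esub> g) =
    (\<one>\<^bsub>A\<^esub> \<oplus>\<^bsub>A\<^esub> group_elem R G s) \<otimes>\<^bsub>A\<^esub> group_elem R G g"
proof -
  interpret A: ring A by (rule ring_A)
  have "s \<otimes>\<^bsub>G\<^esub> (s \<otimes>\<^bsub>G\<^esub> g) = g"
    using assms by (simp add: G.m_assoc [symmetric])
  then show ?thesis
    using assms
    by (simp add: A.l_distr group_elem_in group_elem_mult_group_elem A.a_comm)
qed

theorem theorem7p5:
  fixes R :: "('a, 'c) ring_scheme" and n i j :: nat
  assumes "cring R"
    and "i \<in> {1..n - 1}" and "j \<in> {1..n - 1}" and "i \<le> j"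
  shows "(\<one>\<^bsub>sym_group_algebra R n\<^esub> \<oplus>\<^bsub>sym_group_algebra R n\<^esub> simple_transp R n j)
      \<otimes>\<^bsub>sym_group_algebra R n\<^esub>
      commutator (sym_group_algebra R n) (somewhere_to_below R n i) (somewhere_to_below R n j)
    = \<zero>\<^bsub>sym_group_algebra R n\<^esub>"
proof -
  define A where "A = sym_group_algebra R n"
  define e where "e = group_elem R (sym_group n)"
  define c where "c l m = cycle_of_list [l..<m + 1]" for l m :: nat
  define s where "s = cycle_of_list [j, j + 1]"
  define u where "u = \<one>\<^bsub>A\<^esub> \<oplus>\<^bsub>A\<^esub> e s"
  interpret S: group_algebra_setup R "sym_group n"
    using assms(1) by (simp add: group_algebra_setup_def sym_group_is_group)
  interpret A: ring A
    unfolding A_def by (rule S.ring_A)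
  have e_in: "e g \<in> carrier A" for g
    by (simp add: A_def e_def S.group_elem_in)
  then have u_in: "u \<in> carrier A"
    by (simp add: u_def)
  have c_in: "c l m \<in> carrier (sym_group n)" if "1 \<le> l" "m \<le> n" for l m
    unfolding c_def by (rule cycle_of_interval_in_sym_group [OF that])
  have e_mult: "e (c l m) \<otimes>\<^bsub>A\<^esub> e (c l' m') = e (c l m \<circ> c l' m')"
    if "1 \<le> l" "m \<le> n" "1 \<le> l'" "m' \<le> n" for l m l' m'
    using S.group_elem_mult_group_elem that c_in by (simp add: A_def e_def sym_group_mult)
  define t where "t l = (\<Oplus>\<^bsub>A\<^esub>m\<in>{l..n}. e (c l m))" for l
  have t_in: "t l \<in> carrier A" for l
    by (simp add: t_def e_in)
  have t_eq: "somewhere_to_below R n l = t l" for l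
    by (simp add: somewhere_to_below_def t_def A_def e_def c_def)
  \<comment> \<open>Kept general in \<open>l\<close> and \<open>l'\<close>, so that it expands the
    products in both orders.\<close>
  have u_mult: "u \<otimes>\<^bsub>A\<^esub> (t l \<otimes>\<^bsub>A\<^esub> t l') =
      (\<Oplus>\<^bsub>A\<^esub>p\<in>{l..n} \<times> {l'..n}. case p of (m, k) \<Rightarrow> u \<otimes>\<^bsub>A\<^esub> e (c l m \<circ> c l' k))"
    if "1 \<le> l" "1 \<le> l'" for l l'
  proof -
    have "t l \<otimes>\<^bsub>A\<^esub> t l' = (\<Oplus>\<^bsub>A\<^esub>p\<in>{l..n} \<times> {l'..n}. case p of (m, k) \<Rightarrow> e (c l m) \<otimes>\<^bsub>A\<^esub> e (c l' k))"
      unfolding t_def by (intro A.finsum_mult_finsum) (auto simp: e_in)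
    also have "\<dots> = (\<Oplus>\<^bsub>A\<^esub>p\<in>{l..n} \<times> {l'..n}. case p of (m, k) \<Rightarrow> e (c l m \<circ> c l' k))"
      using that by (intro A.finsum_cong') (auto simp: e_in e_mult)
    finally have "u \<otimes>\<^bsub>A\<^esub> (t l \<otimes>\<^bsub>A\<^esub> t l') =
        u \<otimes>\<^bsub>A\<^esub> (\<Oplus>\<^bsub>A\<^esub>p\<in>{l..n} \<times> {l'..n}. case p of (m, k) \<Rightarrow> e (c l m \<circ> c l' k))"
      by simp
    also have "\<dots> = (\<Oplus>\<^bsub>A\<^esub>p\<in>{l..n} \<times> {l'..n}. u \<otimes>\<^bsub>A\<^esub> (case p of (m, k) \<Rightarrow> e (c l m \<circ> c l' k)))"
      by (intro A.finsum_rdistr) (auto simp: e_in u_in)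
    finally show ?thesis
      by (simp only: case_prod_unfold)
  qed
  \<comment> \<open>The vanishing is restated as an equality of two sums without subtraction; for
    \<open>i = j\<close> both sides are identical.\<close>
  have "u \<otimes>\<^bsub>A\<^esub> (t i \<otimes>\<^bsub>A\<^esub> t j) = u \<otimes>\<^bsub>A\<^esub> (t j \<otimes>\<^bsub>A\<^esub> t i)"
  proof (cases "i = j")
    case False
    \<comment> \<open>Membership of \<open>j\<close> in \<open>{1..n - 1}\<close> rules out
      \<open>n = 0\<close>, so the truncated subtraction still yields
      \<open>j + 1 \<le> n\<close>.\<close>
    with assms have ij: "1 \<le> i" "i < j" "j \<le> n" "j + 1 \<le> n" by auto
    have s_eq: "s = c j (j + 1)"
      by (simp add: s_def c_def)
    have s_in: "s \<in> carrier (sym_group n)"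
      using ij by (simp add: s_eq c_in)
    have "s \<circ> s = id"
      by (simp add: s_def)
    then have absorb: "u \<otimes>\<^bsub>A\<^esub> e (s \<circ> g) = u \<otimes>\<^bsub>A\<^esub> e g" if "g \<in> carrier (sym_group n)" for g
      using S.one_plus_involution_absorb [OF s_in _ that]
      by (simp add: A_def e_def u_def sym_group_mult sym_group_one)
    have comp_in: "c l m \<circ> c l' m' \<in> carrier (sym_group n)"
      if "1 \<le> l" "m \<le> n" "1 \<le> l'" "m' \<le> n" for l m l' m'
      using S.G.m_closed [OF c_in c_in] that by (simp add: sym_group_mult)
    define \<psi> where "\<psi> = (\<lambda>(m, k). if m < j then (k, m) else if k < m then (k + 1, m)
      else if m = j then (j, k) else (k, m - 1))"
    have bij: "bij_betw \<psi> ({i..n} \<times> {j..n}) ({j..n} \<times> {i..n})"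
      unfolding \<psi>_def by (rule bij_betw_cycle_index [OF ij(2,3)])
    \<comment> \<open>Matched permutations agree when \<open>m < j\<close> or \<open>m = j\<close>;
      in the other two cases they differ by a left factor \<open>s\<close>, which \<open>u\<close>
      absorbs.\<close>
    have match: "u \<otimes>\<^bsub>A\<^esub> e (c i m \<circ> c j k) = (case \<psi> (m, k) of (k', m') \<Rightarrow> u \<otimes>\<^bsub>A\<^esub> e (c j k' \<circ> c i m'))"
      if mk: "m \<in> {i..n}" "k \<in> {j..n}" for m k
    proof -
      consider "m < j" | "j \<le> m" "k < m" | "m = j" "j \<le> k" | "j < m" "m \<le> k"
        using mk by fastforce
      then show ?thesis
      proof cases
        case 1
        then show ?thesis
          using cycle_of_interval_commute [of i j k m] ij mk by (simp add: \<psi>_def c_def)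
      next
        case 2
        then have "c i m \<circ> c j k = s \<circ> (c j (k + 1) \<circ> c i m)"
          using cycle_of_interval_comp_less [of i j k m] ij mk by (simp add: c_def s_def)
        then show ?thesis
          using 2 ij mk by (simp add: \<psi>_def absorb comp_in)
      next
        case 3
        then show ?thesis
          using cycle_of_interval_comp_eq [of i j k m] ij mk by (simp add: \<psi>_def c_def)
      next
        case 4
        then have "c i m \<circ> c j k = s \<circ> (c j k \<circ> c i (m - 1))"
          using cycle_of_interval_comp_greater [of i j k m] ij mk by (simp add: c_def s_def)
        then show ?thesis
          using 4 ij mk by (simp add: \<psi>_def absorb comp_in)
      qed
    qed
    let ?f = "\<lambda>(k, m). u \<otimes>\<^bsub>A\<^esub> e (c j k \<circ> c i m)"
    have "u \<otimes>\<^bsub>A\<^esub> (t i \<otimes>\<^bsub>A\<^esub> t j) =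
        (\<Oplus>\<^bsub>A\<^esub>p\<in>{i..n} \<times> {j..n}. case p of (m, k) \<Rightarrow> u \<otimes>\<^bsub>A\<^esub> e (c i m \<circ> c j k))"
      using ij by (intro u_mult) auto
    also have "\<dots> = (\<Oplus>\<^bsub>A\<^esub>p\<in>{i..n} \<times> {j..n}. ?f (\<psi> p))"
      using match by (intro A.finsum_cong') (auto simp: e_in u_in split: prod.split)
    \<comment> \<open>Injectivity of \<open>\<psi>\<close> justifies the reindexing; surjectivity
      then identifies the image with the index set of \<open>t j\<close> times
      \<open>t i\<close>.\<close>
    also have "\<dots> = (\<Oplus>\<^bsub>A\<^esub>p\<in>\<psi> ` ({i..n} \<times> {j..n}). ?f p)"
      using bij by (intro A.finsum_reindex [symmetric]) (auto simp: e_in u_in bij_betw_def)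
    also have "\<dots> = u \<otimes>\<^bsub>A\<^esub> (t j \<otimes>\<^bsub>A\<^esub> t i)"
      using bij ij u_mult [of j i] by (simp add: bij_betw_def)
    finally show ?thesis .
  qed simp
  then have "u \<otimes>\<^bsub>A\<^esub> commutator A (t i) (t j) = \<zero>\<^bsub>A\<^esub>"
    using u_in t_in
    by (simp add: commutator_def A.minus_eq A.r_distr A.r_minus A.r_neg)
  then show ?thesis
    by (simp add: A_def u_def e_def s_def t_eq simple_transp_def)
qed

end
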